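(* For all integers $s\geq 2$, \[\gamma(K_{s+2})\geq 1-\frac{1}{s},\] where $K_{s+2}$ is the complete 3-graph on $s+2$ vertices and $\gamma$ denotes codegree density.
   Context: A 3-graph is a pair $G=(V,E)$ with $V$ a finite vertex set and $E$ a set of 3-element subsets of $V$ (the 3-edges). A 3-graph contains another 3-graph $F$ as a subgraph if it has a (not necessarily induced) subgraph isomorphic to $F$. The complete 3-graph $K_t$ has vertex set $[t]=\{1,\dots,t\}$ and all 3-element subsets of $[t]$ as 3-edges. For a family $\mathcal{F}$ of non-empty 3-graphs (i.e. each having at least one 3-edge), the codegree threshold $\mathrm{coex}(n,\mathcal{F})$ is the largest integer $d$ such that there exists an $n$-vertex 3-graph in which every pair of distinct vertices is contained in at least $d$ 3-edges and which contains no member of $\mathcal{F}$ as a subgraph. The codegree density of $\mathcal{F}$ is $\gamma(\mathcal{F})=\lim_{n\to\infty}\frac{\mathrm{coex}(n,\mathcal{F})}{n-2}$; this limit is known to exist for every such $\mathcal{F}$ (Mubayi and Zhao). For a single 3-graph $F$, write $\gamma(F)=\gamma(\{F\})$. *)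

theory Defs
  imports Complex_Main
begin

type_synonym 'a hypergraph = "'a set \<times> 'a set set"

abbreviation verts :: "'a hypergraph \<Rightarrow> 'a set" where
  "verts G \<equiv> fst G"

abbreviation edges :: "'a hypergraph \<Rightarrow> 'a set set" where
  "edges G \<equiv> snd G"

definition three_graph :: "'a hypergraph \<Rightarrow> bool" where
  "three_graph G \<longleftrightarrow> finite (verts G) \<and> (\<forall>e\<in>edges G. e \<subseteq> verts G \<and> card e = 3)"

definition subgraph :: "'a hypergraph \<Rightarrow> 'a hypergraph \<Rightarrow> bool" where
  "subgraph H G \<longleftrightarrow> three_graph H \<and> verts H \<subseteq> verts G \<and> edges H \<subseteq> edges G"

definition isomorphic :: "'a hypergraph \<Rightarrow> 'b hypergraph \<Rightarrow> bool" where
  "isomorphic G H \<longleftrightarrow>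
     (\<exists>f. bij_betw f (verts G) (verts H) \<and> (\<lambda>e. f ` e) ` edges G = edges H)"

definition contains_copy :: "'a hypergraph \<Rightarrow> 'b hypergraph \<Rightarrow> bool" where
  "contains_copy G F \<longleftrightarrow> (\<exists>H. subgraph H G \<and> isomorphic H F)"

definition complete_three_graph :: "nat \<Rightarrow> nat hypergraph" where
  "complete_three_graph t = ({1..t}, {e. e \<subseteq> {1..t} \<and> card e = 3})"

definition codegree :: "'a hypergraph \<Rightarrow> 'a \<Rightarrow> 'a \<Rightarrow> nat" where
  "codegree G x y = card {e \<in> edges G. x \<in> e \<and> y \<in> e}"

text \<open>Host graphs live on finite sets of naturals, which covers every finite 3-graph up to
  isomorphism. If every member of the family has an edge, then for \<open>n \<ge> 2\<close> the predicate below
  holds for \<open>d = 0\<close> and is bounded in \<open>d\<close>, so the greatest value exists. For \<open>n < 2\<close> the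
  codegree condition is vacuous and the value carries no meaning; this does not affect the
  density, which is a limit.\<close>

definition coex :: "nat \<Rightarrow> 'a hypergraph set \<Rightarrow> nat" where
  "coex n \<F> = (GREATEST d. \<exists>G :: nat hypergraph.
      three_graph G \<and> card (verts G) = n \<and>
      (\<forall>x\<in>verts G. \<forall>y\<in>verts G. x \<noteq> y \<longrightarrow> d \<le> codegree G x y) \<and>
      (\<forall>F\<in>\<F>. \<not> contains_copy G F))"

definition codegree_density :: "'a hypergraph set \<Rightarrow> real" where
  "codegree_density \<F> = lim (\<lambda>n. real (coex n \<F>) / (real n - 2))"

end

theory Submission
  imports Defs "HOL-Library.FuncSet" "HOL-Real_Asymp.Real_Asymp"
begin

text \<open>For the lower bound, colour the pairs \<open>i < j\<close> below \<open>n\<close> independently and uniformly with \<open>s\<close>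
  colours, and let \<open>{i, j, k}\<close> with \<open>i < j < k\<close> be an edge iff \<open>(i, j)\<close> and \<open>(i, k)\<close> have
  different colours. Among \<open>s + 2\<close> vertices, two of the \<open>s + 1\<close> pairs at the least vertex
  share a colour, so there is no complete 3-graph on \<open>s + 2\<close> vertices. For fixed \<open>x < y\<close>,
  each third vertex completes an edge independently with probability \<open>1 - 1 / s\<close>, so a Chernoff
  bound makes all codegrees almost \<open>(1 - 1 / s) n\<close>.

  The density is defined by a limit, whose existence has to be shown as well. By the same
  Chernoff bound, a random \<open>m\<close>-tuple of vertices of a huge 3-graph inherits its minimum relative
  codegree up to \<open>\<epsilon>\<close>. Hence \<open>coex n / n\<close> is almost decreasing, and so it converges.\<close>

section \<open>Counting functions: exponential moments, Chernoff bounds, collisions\<close>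

text \<open>Independence of the coordinates of a uniformly random function, in counting form: it
  makes the exponential moment of a number of hits factor over the coordinates.\<close>

lemma sum_PiE_prod:
  fixes h :: "'a \<Rightarrow> 'b \<Rightarrow> 'c :: comm_semiring_1"
  assumes "finite S"
  shows "(\<Sum>g\<in>S \<rightarrow>\<^sub>E W. \<Prod>i\<in>S. h i (g i)) = (\<Prod>i\<in>S. \<Sum>w\<in>W. h i w)"
  using assms
proof (induction S rule: finite_induct)
  case empty
  then show ?case by simp
next
  case (insert x S)
  have "(\<Sum>g\<in>insert x S \<rightarrow>\<^sub>E W. \<Prod>i\<in>insert x S. h i (g i))
      = (\<Sum>(y, g)\<in>W \<times> (S \<rightarrow>\<^sub>E W). \<Prod>i\<in>insert x S. h i ((g(x := y)) i))"
    unfolding PiE_insert_eq using insert.hyps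
    by (subst sum.reindex[OF inj_combinator]) (auto simp: case_prod_beta o_def)
  also have "\<dots> = (\<Sum>(y, g)\<in>W \<times> (S \<rightarrow>\<^sub>E W). h x y * (\<Prod>i\<in>S. h i (g i)))"
  proof (rule sum.cong[OF refl], clarify)
    fix y g
    have "(\<Prod>i\<in>S. h i ((g(x := y)) i)) = (\<Prod>i\<in>S. h i (g i))"
      using insert.hyps by (intro prod.cong) auto
    then show "(\<Prod>i\<in>insert x S. h i ((g(x := y)) i)) = h x y * (\<Prod>i\<in>S. h i (g i))"
      using insert.hyps by simp
  qed
  also have "\<dots> = (\<Sum>y\<in>W. h x y) * (\<Sum>g\<in>S \<rightarrow>\<^sub>E W. \<Prod>i\<in>S. h i (g i))"
    by (simp add: sum.cartesian_product[symmetric] sum_product)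
  finally show ?case using insert by simp
qed

text \<open>A Chernoff bound by exponential moments. Replacing \<open>exp (- \<epsilon>)\<close> by \<open>1 / (1 + \<epsilon>)\<close> costs the
  factor 2 in front of \<open>\<epsilon>\<close>.\<close>

lemma card_few_hits_le:
  fixes p \<epsilon> :: real
  assumes "finite S" "finite W" "0 \<le> p" "p \<le> 1" "0 \<le> \<epsilon>"
    and T: "\<And>i. i \<in> S \<Longrightarrow> T i \<subseteq> W" "\<And>i. i \<in> S \<Longrightarrow> p * card W \<le> card (T i)"
  shows "card {g \<in> S \<rightarrow>\<^sub>E W. card {i \<in> S. g i \<in> T i} < (p - 2 * \<epsilon>) * card S}
    \<le> exp (- (\<epsilon>\<^sup>2 * card S)) * card W ^ card S"
proof -
  define thr where "thr = (p - 2 * \<epsilon>) * card S"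
  define hits where "hits g = card {i \<in> S. g i \<in> T i}" for g
  let ?\<Omega> = "S \<rightarrow>\<^sub>E W"
  have fin: "finite ?\<Omega>" using assms by (simp add: finite_PiE)
  have "real (card {g \<in> ?\<Omega>. hits g < thr}) = (\<Sum>g\<in>{g \<in> ?\<Omega>. hits g < thr}. 1)"
    by simp
  \<comment> \<open>Markov's inequality for the exponential moment: on the bad functions the
    exponent is nonnegative, so each weight is at least 1. The positive weights of the other
    functions are added next.\<close>
  also have "\<dots> \<le> (\<Sum>g\<in>{g \<in> ?\<Omega>. hits g < thr}. exp (\<epsilon> * (thr - hits g)))"
    using \<open>0 \<le> \<epsilon>\<close> by (intro sum_mono) auto
  also have "\<dots> \<le> (\<Sum>g\<in>?\<Omega>. exp (\<epsilon> * (thr - hits g)))"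
    using fin by (intro sum_mono2) auto
  also have "\<dots> = (\<Sum>g\<in>?\<Omega>. exp (\<epsilon> * thr) * (\<Prod>i\<in>S. exp (- \<epsilon> * of_bool (g i \<in> T i))))"
  proof (rule sum.cong[OF refl])
    fix g
    have "real (hits g) = (\<Sum>i\<in>S. of_bool (g i \<in> T i))"
      using \<open>finite S\<close> by (simp add: hits_def Int_def)
    then have "\<epsilon> * (thr - hits g) = \<epsilon> * thr + (\<Sum>i\<in>S. - \<epsilon> * of_bool (g i \<in> T i))"
      by (simp add: right_diff_distrib sum_distrib_left sum_negf)
    then show "exp (\<epsilon> * (thr - hits g)) = exp (\<epsilon> * thr) * (\<Prod>i\<in>S. exp (- \<epsilon> * of_bool (g i \<in> T i)))"
      using \<open>finite S\<close> by (simp only: exp_add exp_sum)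
  qed
  also have "\<dots> = exp (\<epsilon> * thr) * (\<Prod>i\<in>S. \<Sum>w\<in>W. exp (- \<epsilon> * of_bool (w \<in> T i)))"
    using sum_PiE_prod[OF \<open>finite S\<close>, of "\<lambda>i w. exp (- \<epsilon> * of_bool (w \<in> T i))" W]
    by (simp add: sum_distrib_left[symmetric])
  also have "\<dots> \<le> exp (\<epsilon> * thr) * (\<Prod>i\<in>S. card W * exp (\<epsilon>\<^sup>2 - p * \<epsilon>))"
  proof (intro mult_left_mono prod_mono conjI)
    fix i assume i: "i \<in> S"
    have fT: "finite (T i)" using T(1)[OF i] \<open>finite W\<close> finite_subset by blast
    have "(\<Sum>w\<in>W. exp (- \<epsilon> * of_bool (w \<in> T i))) = (\<Sum>w\<in>W. 1 - (1 - exp (- \<epsilon>)) * of_bool (w \<in> T i))"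
      by (intro sum.cong) auto
    also have "\<dots> = card W - (1 - exp (- \<epsilon>)) * card (T i)"
      using \<open>finite W\<close> T(1)[OF i]
      by (simp add: sum_subtractf sum_distrib_left[symmetric] Int_absorb1 Int_def[symmetric] Int_commute)
    also have "\<dots> \<le> card W - (1 - exp (- \<epsilon>)) * (p * card W)"
      using T(2)[OF i] \<open>0 \<le> \<epsilon>\<close> by (intro diff_left_mono mult_left_mono) auto
    also have "\<dots> = card W * (1 - p * (1 - exp (- \<epsilon>)))"
      by (simp add: algebra_simps)
    also have "\<dots> \<le> card W * exp (\<epsilon>\<^sup>2 - p * \<epsilon>)"
    proof (rule mult_left_mono)
      have "(1 + \<epsilon>) * exp (- \<epsilon>) \<le> 1"
        using exp_ge_add_one_self[of \<epsilon>] by (simp add: exp_minus field_simps)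
      \<comment> \<open>The product equals \<open>1 + \<epsilon> ^ 3\<close>.\<close>
      moreover have "(1 + \<epsilon>) * (1 - \<epsilon> + \<epsilon>\<^sup>2) \<ge> 1"
        using \<open>0 \<le> \<epsilon>\<close> by (simp add: algebra_simps power2_eq_square)
      ultimately have "(1 + \<epsilon>) * exp (- \<epsilon>) \<le> (1 + \<epsilon>) * (1 - \<epsilon> + \<epsilon>\<^sup>2)" by linarith
      then have "exp (- \<epsilon>) \<le> 1 - \<epsilon> + \<epsilon>\<^sup>2"
        using \<open>0 \<le> \<epsilon>\<close> by (simp add: mult_le_cancel_left)
      then have "p * (\<epsilon> - \<epsilon>\<^sup>2) \<le> p * (1 - exp (- \<epsilon>))"
        using \<open>0 \<le> p\<close> by (intro mult_left_mono) auto
      moreover have "p * \<epsilon>\<^sup>2 \<le> \<epsilon>\<^sup>2"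
        using \<open>p \<le> 1\<close> by (simp add: mult_left_le_one_le \<open>0 \<le> p\<close>)
      ultimately have "1 - p * (1 - exp (- \<epsilon>)) \<le> 1 + (\<epsilon>\<^sup>2 - p * \<epsilon>)"
        by (simp add: algebra_simps)
      also have "\<dots> \<le> exp (\<epsilon>\<^sup>2 - p * \<epsilon>)" by (rule exp_ge_add_one_self)
      finally show "1 - p * (1 - exp (- \<epsilon>)) \<le> exp (\<epsilon>\<^sup>2 - p * \<epsilon>)" .
    qed simp
    finally show "(\<Sum>w\<in>W. exp (- \<epsilon> * of_bool (w \<in> T i))) \<le> card W * exp (\<epsilon>\<^sup>2 - p * \<epsilon>)" .
  qed (auto intro: sum_nonneg)
  also have "\<dots> = exp (\<epsilon> * thr + card S * (\<epsilon>\<^sup>2 - p * \<epsilon>)) * card W ^ card S"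
    by (simp add: power_mult_distrib exp_add exp_of_nat_mult)
  \<comment> \<open>Of the slack \<open>2 * \<epsilon>\<close> in \<open>thr\<close>, one half
    absorbs the second-order error \<open>\<epsilon>\<^sup>2\<close> per coordinate and the other
    half gives the decay.\<close>
  also have "\<epsilon> * thr + card S * (\<epsilon>\<^sup>2 - p * \<epsilon>) = - (\<epsilon>\<^sup>2 * card S)"
    by (simp add: thr_def algebra_simps power2_eq_square)
  finally show ?thesis by (simp add: thr_def hits_def)
qed

text \<open>Conditioning on the coordinates outside \<open>e ` S\<close>: the target sets may depend on these.\<close>

lemma card_few_hits_le_conditional:
  fixes p \<epsilon> :: real
  assumes "finite I" "finite W" "0 \<le> p" "p \<le> 1" "0 \<le> \<epsilon>"
    and e: "inj_on e S" "e ` S \<subseteq> I"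
    and loc: "\<And>f f' i. i \<in> S \<Longrightarrow> (\<And>x. x \<in> I - e ` S \<Longrightarrow> f x = f' x) \<Longrightarrow> T f i = T f' i"
    and T: "\<And>f i. f \<in> I - e ` S \<rightarrow> W \<Longrightarrow> i \<in> S \<Longrightarrow> T f i \<subseteq> W"
      "\<And>f i. f \<in> I - e ` S \<rightarrow> W \<Longrightarrow> i \<in> S \<Longrightarrow> p * card W \<le> card (T f i)"
  shows "card {f \<in> I \<rightarrow>\<^sub>E W. card {i \<in> S. f (e i) \<in> T f i} < (p - 2 * \<epsilon>) * card S}
    \<le> exp (- (\<epsilon>\<^sup>2 * card S)) * card W ^ card I"
proof -
  define J where "J = I - e ` S"
  define bad where "bad h = {g \<in> S \<rightarrow>\<^sub>E W. card {i \<in> S. g i \<in> T h i} < (p - 2 * \<epsilon>) * card S}" for h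
  let ?B = "{f \<in> I \<rightarrow>\<^sub>E W. card {i \<in> S. f (e i) \<in> T f i} < (p - 2 * \<epsilon>) * card S}"
  \<comment> \<open>Splits \<open>f\<close> into the coordinates that are conditioned on and those
    along \<open>e\<close>, reindexed by \<open>S\<close>. Bad functions then fall into the fibres
    \<open>bad h\<close>, and each fibre is small by the unconditional bound.\<close>
  let ?\<phi> = "\<lambda>f. (restrict f J, \<lambda>i\<in>S. f (e i))"
  have finS: "finite S" using e \<open>finite I\<close> finite_subset finite_imageD by metis
  have finJ: "finite J" using \<open>finite I\<close> by (simp add: J_def)
  have fin_bad: "finite (bad h)" for h
    using finS \<open>finite W\<close> by (simp add: bad_def finite_PiE)
  have "inj_on ?\<phi> ?B"
  proof (rule inj_onI)
    fix f f' assume "f \<in> ?B" "f' \<in> ?B" and eq: "?\<phi> f = ?\<phi> f'"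
    then have ff: "f \<in> I \<rightarrow>\<^sub>E W" "f' \<in> I \<rightarrow>\<^sub>E W" by auto
    have "f x = f' x" if "x \<in> I" for x
    proof (cases "x \<in> J")
      case True
      then show ?thesis using eq by (metis prod.inject restrict_apply')
    next
      case False
      with that obtain i where "i \<in> S" "x = e i" by (auto simp: J_def)
      then show ?thesis using eq by (metis (no_types, lifting) prod.inject restrict_apply')
    qed
    then show "f = f'" using ff by (rule_tac PiE_ext) auto
  qed
  moreover have "?\<phi> ` ?B \<subseteq> Sigma (J \<rightarrow>\<^sub>E W) bad"
  proof (rule image_subsetI)
    fix f assume f: "f \<in> ?B"
    \<comment> \<open>Locality makes the target sets a function of the first component alone, so
      that they are fixed within a fibre.\<close>
    have "T (restrict f J) i = T f i" if "i \<in> S" for i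
      using that by (intro loc) (auto simp: J_def)
    then have "{i \<in> S. (\<lambda>i\<in>S. f (e i)) i \<in> T (restrict f J) i} = {i \<in> S. f (e i) \<in> T f i}"
      by auto
    then show "?\<phi> f \<in> Sigma (J \<rightarrow>\<^sub>E W) bad"
      using f e by (auto simp: bad_def J_def PiE_iff)
  qed
  moreover have "finite (Sigma (J \<rightarrow>\<^sub>E W) bad)"
    using finJ \<open>finite W\<close> fin_bad by (intro finite_SigmaI finite_PiE) auto
  ultimately have "card ?B \<le> card (Sigma (J \<rightarrow>\<^sub>E W) bad)"
    by (rule card_inj_on_le)
  also have "\<dots> = (\<Sum>h\<in>J \<rightarrow>\<^sub>E W. card (bad h))"
    using finJ \<open>finite W\<close> fin_bad by (intro card_SigmaI finite_PiE) auto
  finally have "real (card ?B) \<le> (\<Sum>h\<in>J \<rightarrow>\<^sub>E W. real (card (bad h)))"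
    by (simp only: of_nat_sum[symmetric] of_nat_le_iff)
  also have "\<dots> \<le> (\<Sum>h\<in>J \<rightarrow>\<^sub>E W. exp (- (\<epsilon>\<^sup>2 * card S)) * card W ^ card S)"
  proof (rule sum_mono)
    fix h assume "h \<in> J \<rightarrow>\<^sub>E W"
    then have "h \<in> I - e ` S \<rightarrow> W" by (auto simp: J_def)
    then show "real (card (bad h)) \<le> exp (- (\<epsilon>\<^sup>2 * card S)) * card W ^ card S"
      unfolding bad_def using T by (intro card_few_hits_le finS assms(2-5)) blast+
  qed
  also have "\<dots> = exp (- (\<epsilon>\<^sup>2 * card S)) * card W ^ card I"
  proof -
    have "card I = card (e ` S) + card J"
      unfolding J_def using e \<open>finite I\<close> finS
      by (simp add: card_Diff_subset card_mono)
    then show ?thesis using finJ e by (simp add: card_PiE card_image power_add)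
  qed
  finally show ?thesis .
qed

text \<open>The value at \<open>b\<close> is determined by the value at \<open>a\<close>, so one
  coordinate is lost. As a probability: two given coordinates collide with probability at most
  \<open>1 / card W\<close>.\<close>

lemma card_PiE_eq_at_le:
  assumes "finite I" "finite W" "a \<in> I" "b \<in> I" "a \<noteq> b"
  shows "card {f \<in> I \<rightarrow>\<^sub>E W. f a = f b} \<le> card W ^ (card I - 1)"
proof -
  have "inj_on (\<lambda>f. restrict f (I - {b})) {f \<in> I \<rightarrow>\<^sub>E W. f a = f b}"
  proof (rule inj_onI)
    fix f f' assume f: "f \<in> {f \<in> I \<rightarrow>\<^sub>E W. f a = f b}" "f' \<in> {f \<in> I \<rightarrow>\<^sub>E W. f a = f b}"
      and eq: "restrict f (I - {b}) = restrict f' (I - {b})"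
    have *: "f x = f' x" if "x \<in> I - {b}" for x
      using that eq by (metis restrict_apply')
    have "f x = f' x" if "x \<in> I" for x
      using that f *[of x] *[of a] assms by (cases "x = b") auto
    then show "f = f'" using f by (intro PiE_ext[of f I "\<lambda>_. W"]) auto
  qed
  moreover have "(\<lambda>f. restrict f (I - {b})) ` {f \<in> I \<rightarrow>\<^sub>E W. f a = f b} \<subseteq> (I - {b}) \<rightarrow>\<^sub>E W"
    by (auto simp: PiE_iff split: if_splits)
  moreover have "finite ((I - {b}) \<rightarrow>\<^sub>E W)"
    using assms by (intro finite_PiE) auto
  ultimately have "card {f \<in> I \<rightarrow>\<^sub>E W. f a = f b} \<le> card ((I - {b}) \<rightarrow>\<^sub>E W)"
    by (rule card_inj_on_le)
  then show ?thesis using assms by (simp add: card_PiE)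
qed

section \<open>Codegrees and the extremal number\<close>

text \<open>An edge through \<open>x\<close> and \<open>y\<close> is determined by its third vertex.
  In this form codegrees can be compared with numbers of hits.\<close>

lemma codegree_eq_card:
  assumes "three_graph G" "x \<noteq> y"
  shows "codegree G x y = card {z \<in> verts G - {x, y}. {x, y, z} \<in> edges G}"
proof -
  have "{e \<in> edges G. x \<in> e \<and> y \<in> e}
      = (\<lambda>z. {x, y, z}) ` {z \<in> verts G - {x, y}. {x, y, z} \<in> edges G}"
  proof (intro equalityI subsetI)
    fix e assume e: "e \<in> {e \<in> edges G. x \<in> e \<and> y \<in> e}"
    then have c: "card e = 3" "e \<subseteq> verts G" "x \<in> e" "y \<in> e" "e \<in> edges G"
      using assms by (auto simp: three_graph_def)
    then have "finite e" by (metis card.infinite zero_neq_numeral)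
    then have "card (e - {x, y}) = 1"
      using c assms by (simp add: card_Diff_subset)
    then obtain z where "e - {x, y} = {z}" by (auto simp: card_1_singleton_iff)
    then have "e = {x, y, z}" "z \<in> verts G - {x, y}" using c by auto
    then show "e \<in> (\<lambda>z. {x, y, z}) ` {z \<in> verts G - {x, y}. {x, y, z} \<in> edges G}"
      using c by auto
  qed auto
  moreover have "inj_on (\<lambda>z. {x, y, z}) {z \<in> verts G - {x, y}. {x, y, z} \<in> edges G}"
    by (auto simp: inj_on_def)
  ultimately show ?thesis by (simp add: codegree_def card_image)
qed

lemma codegree_sym: "codegree G x y = codegree G y x"
  by (simp add: codegree_def conj_commute)

text \<open>The predicate under \<open>GREATEST\<close> in \<open>coex\<close>, named so that
  attainment and maximality can be used separately.\<close>

definition coex_attains :: "nat \<Rightarrow> 'a hypergraph set \<Rightarrow> nat \<Rightarrow> bool" where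
  "coex_attains n \<F> d \<longleftrightarrow> (\<exists>G :: nat hypergraph. three_graph G \<and> card (verts G) = n \<and>
      (\<forall>x\<in>verts G. \<forall>y\<in>verts G. x \<noteq> y \<longrightarrow> d \<le> codegree G x y) \<and>
      (\<forall>F\<in>\<F>. \<not> contains_copy G F))"

text \<open>For \<open>n \<ge> 2\<close> there is a pair of vertices, and its codegree counts
  vertices. This is the boundedness on which the \<open>GREATEST\<close> operator relies.\<close>

lemma coex_attains_le:
  assumes "coex_attains n \<F> d" "n \<ge> 2"
  shows "d \<le> n"
proof -
  obtain G :: "nat hypergraph" where G: "three_graph G" "card (verts G) = n"
    "\<And>x y. x \<in> verts G \<Longrightarrow> y \<in> verts G \<Longrightarrow> x \<noteq> y \<Longrightarrow> d \<le> codegree G x y"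
    using assms unfolding coex_attains_def by blast
  have fin: "finite (verts G)" using G by (simp add: three_graph_def)
  obtain x y where xy: "x \<in> verts G" "y \<in> verts G" "x \<noteq> y"
    using assms(2) G(2) card_le_Suc0_iff_eq[OF fin] by fastforce
  have "d \<le> card {z \<in> verts G - {x, y}. {x, y, z} \<in> edges G}"
    using G(3)[OF xy] codegree_eq_card[OF G(1) xy(3)] by simp
  also have "\<dots> \<le> card (verts G)" using fin by (intro card_mono) auto
  finally show ?thesis using G by simp
qed

lemma coex_eq_Greatest: "coex n \<F> = Greatest (coex_attains n \<F>)"
  unfolding coex_def coex_attains_def ..

lemma le_coexI:
  assumes "coex_attains n \<F> d" "n \<ge> 2"
  shows "d \<le> coex n \<F>"
  unfolding coex_eq_Greatest using assms coex_attains_le by (metis Greatest_le_nat)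

lemma coex_attains_coex:
  assumes "n \<ge> 2" "\<And>F. F \<in> \<F> \<Longrightarrow> edges F \<noteq> {}"
  shows "coex_attains n \<F> (coex n \<F>)"
proof -
  \<comment> \<open>The edgeless 3-graph attains 0: it contains no member of the family, as each has
    an edge.\<close>
  let ?G = "({..<n}, {}) :: nat hypergraph"
  have "\<not> contains_copy ?G F" if "F \<in> \<F>" for F
    using assms(2)[OF that] by (auto simp: contains_copy_def subgraph_def isomorphic_def)
  then have "coex_attains n \<F> 0"
    unfolding coex_attains_def by (intro exI[of _ ?G]) (auto simp: three_graph_def)
  then show ?thesis
    unfolding coex_eq_Greatest using assms(1) coex_attains_le by (metis GreatestI_nat)
qed

section \<open>Random samples of a 3-graph\<close>

text \<open>The map \<open>f\<close> carries a copy in the pulled-back 3-graph into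
  \<open>G\<close>; injectivity preserves the isomorphism type and the edge size. Hence samples of
  \<open>G\<close> inherit its freeness.\<close>

lemma contains_copy_pullback:
  assumes "inj_on f A" "f ` A \<subseteq> verts G"
    and copy: "contains_copy (A, {e. e \<subseteq> A \<and> card e = 3 \<and> f ` e \<in> edges G}) F"
  shows "contains_copy G F"
proof -
  obtain H h where H: "three_graph H" "verts H \<subseteq> A"
      "edges H \<subseteq> {e. e \<subseteq> A \<and> card e = 3 \<and> f ` e \<in> edges G}"
    and h: "bij_betw h (verts H) (verts F)" "(`) h ` edges H = edges F"
    using copy by (auto simp: contains_copy_def subgraph_def isomorphic_def)
  define H' where "H' = (f ` verts H, (`) f ` edges H)"
  have inj: "inj_on f (verts H)" using assms(1) H(2) inj_on_subset by blast
  have edge: "e \<subseteq> verts H" "card (f ` e) = 3" if "e \<in> edges H" for e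
  proof -
    show "e \<subseteq> verts H" using H(1) that by (auto simp: three_graph_def)
    then have "inj_on f e" using inj inj_on_subset by blast
    then show "card (f ` e) = 3" using H(1) that by (simp add: card_image three_graph_def)
  qed
  have "three_graph H'"
    using H(1) edge by (auto simp: three_graph_def H'_def)
  then have "subgraph H' G"
    using assms(2) H by (auto simp: subgraph_def H'_def)
  moreover have "isomorphic H' F"
    unfolding isomorphic_def
  proof (intro exI conjI)
    let ?k = "h \<circ> inv_into (verts H) f"
    show "bij_betw ?k (verts H') (verts F)"
      unfolding H'_def using bij_betw_trans[OF bij_betw_inv_into[OF inj_on_imp_bij_betw[OF inj]] h(1)]
      by simp
    have "?k ` f ` e = h ` e" if "e \<in> edges H" for e
      using edge(1)[OF that] inj
      by (force simp: image_image intro!: image_cong)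
    then show "(\<lambda>e. ?k ` e) ` edges H' = edges F"
      unfolding H'_def h(2)[symmetric] by (simp add: image_image)
  qed
  ultimately show ?thesis unfolding contains_copy_def by blast
qed

text \<open>Union bound over the at most \<open>m ^ 2\<close> ordered pairs of indices of a random
  \<open>m\<close>-tuple of vertices. A pair collides with probability at most \<open>1 / N\<close>;
  it is collision-free with too few completing indices with probability at most
  \<open>exp (- (\<epsilon>\<^sup>2 * (real m - 2)))\<close>. A tuple avoiding all these events is
  injective, and pulling \<open>G\<close> back along it gives the witness.\<close>

lemma coex_attains_sample:
  fixes G :: "'a hypergraph" and p \<epsilon> :: real
  assumes G: "three_graph G" "card (verts G) = N" "N > 0"
    and cod: "\<And>x y. x \<in> verts G \<Longrightarrow> y \<in> verts G \<Longrightarrow> x \<noteq> y \<Longrightarrow> p * N \<le> codegree G x y"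
    and free: "\<And>F. F \<in> \<F> \<Longrightarrow> \<not> contains_copy G F"
    and p: "0 \<le> p" "p \<le> 1" "0 \<le> \<epsilon>" and m: "m \<ge> 2"
    and small: "real m ^ 2 * (exp (- (\<epsilon>\<^sup>2 * (real m - 2))) + 1 / N) < 1"
  shows "coex_attains m \<F> (nat \<lceil>(p - 2 * \<epsilon>) * (real m - 2)\<rceil>)"
proof -
  define V where "V = verts G"
  define I where "I = {..<m}"
  define S where "S a b = I - {a, b}" for a b
  define hits where "hits f a b = card {c \<in> S a b. {f a, f b, f c} \<in> edges G}" for f a b
  define \<Omega> where "\<Omega> = I \<rightarrow>\<^sub>E V"
  define B where "B = (\<lambda>(a, b). {f \<in> \<Omega>. f a = f b} \<union>
     {f \<in> \<Omega>. f a \<noteq> f b \<and> hits f a b < (p - 2 * \<epsilon>) * card (S a b)})"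
  define D where "D = {(a, b). a \<in> I \<and> b \<in> I \<and> a \<noteq> b}"
  have finV: "finite V" and cardV: "card V = N" using G by (auto simp: V_def three_graph_def)
  have finI: "finite I" and cardI: "card I = m" by (auto simp: I_def)
  have fin\<Omega>: "finite \<Omega>" unfolding \<Omega>_def using finV finI by (intro finite_PiE) auto
  have DI: "D \<subseteq> I \<times> I" by (auto simp: D_def)
  then have finD: "finite D" using finI finite_subset by blast
  have cardS: "real (card (S a b)) = real m - 2" if "(a, b) \<in> D" for a b
    using that finI cardI m by (auto simp: S_def D_def card_Diff_subset of_nat_diff)
  have cardB: "real (card (B ab)) \<le> (exp (- (\<epsilon>\<^sup>2 * (real m - 2))) + 1 / N) * real N ^ m" if ab_D: "ab \<in> D" for ab
  proof -
    obtain a b where ab: "ab = (a, b)" "a \<in> I" "b \<in> I" "a \<noteq> b" using ab_D by (auto simp: D_def)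
    \<comment> \<open>For colliding \<open>f a = f b\<close> the codegree hypothesis says nothing,
      so \<open>T\<close> is then all of \<open>V\<close>. This gives the required size for every
      \<open>f\<close>, while such \<open>f\<close> are excluded from the event being
      bounded.\<close>
    define T where "T f (i::nat) = {z \<in> V. f a = f b \<or> {f a, f b, z} \<in> edges G}" for f i
    have "card {f \<in> \<Omega>. f a = f b} \<le> N ^ (m - 1)"
      unfolding \<Omega>_def using card_PiE_eq_at_le[OF finI finV ab(2-4)] cardI cardV by simp
    then have "real (card {f \<in> \<Omega>. f a = f b}) \<le> real N ^ (m - 1)"
      by (simp only: of_nat_power[symmetric] of_nat_le_iff)
    also have "\<dots> = 1 / N * real N ^ m"
      using m \<open>N > 0\<close> by (cases m) auto
    finally have 1: "real (card {f \<in> \<Omega>. f a = f b}) \<le> 1 / N * real N ^ m" .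
    have sub: "{f \<in> \<Omega>. f a \<noteq> f b \<and> hits f a b < (p - 2 * \<epsilon>) * card (S a b)}
       \<subseteq> {f \<in> I \<rightarrow>\<^sub>E V. card {i \<in> S a b. f (id i) \<in> T f i} < (p - 2 * \<epsilon>) * card (S a b)}"
    proof
      fix f assume f: "f \<in> {f \<in> \<Omega>. f a \<noteq> f b \<and> hits f a b < (p - 2 * \<epsilon>) * card (S a b)}"
      have "{i \<in> S a b. f (id i) \<in> T f i} = {c \<in> S a b. {f a, f b, f c} \<in> edges G}"
        using f by (auto simp: T_def \<Omega>_def S_def)
      then show "f \<in> {f \<in> I \<rightarrow>\<^sub>E V. card {i \<in> S a b. f (id i) \<in> T f i} < (p - 2 * \<epsilon>) * card (S a b)}"
        using f by (simp add: hits_def \<Omega>_def)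
    qed
    have "card {f \<in> I \<rightarrow>\<^sub>E V. card {i \<in> S a b. f (id i) \<in> T f i} < (p - 2 * \<epsilon>) * card (S a b)}
      \<le> exp (- (\<epsilon>\<^sup>2 * card (S a b))) * card V ^ card I"
    proof (rule card_few_hits_le_conditional[OF finI finV p])
      fix f i assume f: "f \<in> I - id ` S a b \<rightarrow> V" and i: "i \<in> S a b"
      have fab: "f a \<in> V" "f b \<in> V" using f ab by (auto simp: S_def)
      show "p * card V \<le> card (T f i)"
      proof (cases "f a = f b")
        case True
        then show ?thesis using p by (simp add: T_def mult_left_le_one_le)
      next
        case False
        have "p * card V \<le> codegree G (f a) (f b)"
          using cod fab False by (simp add: V_def[symmetric] cardV)
        also have "codegree G (f a) (f b) \<le> card (T f i)"
          unfolding codegree_eq_card[OF G(1) False] using finV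
          by (intro card_mono) (auto simp: T_def V_def)
        finally show ?thesis by simp
      qed
    next
      fix f f' :: "nat \<Rightarrow> 'a" and i
      assume eq: "\<And>x. x \<in> I - id ` S a b \<Longrightarrow> f x = f' x"
      have "f a = f' a" "f b = f' b" using eq ab by (auto simp: S_def)
      then show "T f i = T f' i" by (simp add: T_def)
    qed (auto simp: S_def T_def)
    then have 2: "real (card {f \<in> \<Omega>. f a \<noteq> f b \<and> hits f a b < (p - 2 * \<epsilon>) * card (S a b)})
        \<le> exp (- (\<epsilon>\<^sup>2 * (real m - 2))) * real N ^ m"
      using card_mono[OF _ sub] fin\<Omega> cardS[of a b] ab_D ab cardV cardI by (simp add: \<Omega>_def)
    have "real (card (B ab)) \<le> real (card {f \<in> \<Omega>. f a = f b})
       + real (card {f \<in> \<Omega>. f a \<noteq> f b \<and> hits f a b < (p - 2 * \<epsilon>) * card (S a b)})"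
      unfolding ab B_def prod.case of_nat_add[symmetric] of_nat_le_iff by (rule card_Un_le)
    with 1 2 show ?thesis by (simp add: algebra_simps)
  qed
  have "real (card (\<Union>ab\<in>D. B ab)) \<le> real (\<Sum>ab\<in>D. card (B ab))"
    using card_UN_le[OF finD] by (simp only: of_nat_le_iff)
  also have "\<dots> \<le> (\<Sum>ab\<in>D. (exp (- (\<epsilon>\<^sup>2 * (real m - 2))) + 1 / N) * real N ^ m)"
    unfolding of_nat_sum using cardB by (intro sum_mono)
  also have "\<dots> = real (card D) * ((exp (- (\<epsilon>\<^sup>2 * (real m - 2))) + 1 / N) * real N ^ m)"
    by simp
  also have "\<dots> \<le> real m ^ 2 * ((exp (- (\<epsilon>\<^sup>2 * (real m - 2))) + 1 / N) * real N ^ m)"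
  proof (rule mult_right_mono)
    have "card D \<le> card (I \<times> I)" using DI finI by (intro card_mono) auto
    then show "real (card D) \<le> real m ^ 2"
      using cardI by (simp add: card_cartesian_product power2_eq_square flip: of_nat_mult)
  qed (simp add: add_nonneg_nonneg)
  also have "\<dots> = (real m ^ 2 * (exp (- (\<epsilon>\<^sup>2 * (real m - 2))) + 1 / N)) * real N ^ m"
    by simp
  also have "\<dots> < 1 * real N ^ m"
    using small \<open>N > 0\<close> by (intro mult_strict_right_mono) auto
  also have "\<dots> = card \<Omega>" using finI cardI cardV by (simp add: \<Omega>_def card_PiE)
  finally have "card (\<Union>ab\<in>D. B ab) < card \<Omega>" by simp
  moreover have "(\<Union>ab\<in>D. B ab) \<subseteq> \<Omega>" by (auto simp: B_def)
  ultimately obtain f where f: "f \<in> \<Omega>" "f \<notin> (\<Union>ab\<in>D. B ab)"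
    by (metis less_irrefl subsetI subset_antisym)
  have good: "f a \<noteq> f b" "(p - 2 * \<epsilon>) * (real m - 2) \<le> hits f a b"
    if "a \<in> I" "b \<in> I" "a \<noteq> b" for a b
  proof -
    have "(a, b) \<in> D" using that by (simp add: D_def)
    then have "f \<notin> B (a, b)" "card (S a b) = real m - 2" using f(2) cardS by auto
    then show "f a \<noteq> f b" "(p - 2 * \<epsilon>) * (real m - 2) \<le> hits f a b"
      using f(1) by (auto simp: B_def)
  qed
  then have inj: "inj_on f I" by (meson inj_onI)
  define G' where "G' = (I, {e. e \<subseteq> I \<and> card e = 3 \<and> f ` e \<in> edges G})"
  have G': "three_graph G'" using finI by (simp add: three_graph_def G'_def)
  show ?thesis unfolding coex_attains_def
  proof (intro exI conjI ballI impI)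
    show "three_graph G'" by (rule G')
    show "card (verts G') = m" by (simp add: G'_def cardI)
    show "\<not> contains_copy G' F" if "F \<in> \<F>" for F
      using contains_copy_pullback[OF inj, of G F] free[OF that] f(1)
      by (auto simp: G'_def \<Omega>_def V_def)
    fix a b assume "a \<in> verts G'" "b \<in> verts G'" and ab: "a \<noteq> b"
    then have abI: "a \<in> I" "b \<in> I" by (auto simp: G'_def)
    have "hits f a b \<le> codegree G' a b"
      unfolding hits_def codegree_eq_card[OF G' ab] using ab abI finI
      by (intro card_mono) (auto simp: G'_def S_def)
    with good(2)[OF abI ab] show "nat \<lceil>(p - 2 * \<epsilon>) * (real m - 2)\<rceil> \<le> codegree G' a b"
      by linarith
  qed
qed

section \<open>Convergence of the relative extremal number\<close>

text \<open>Passing from \<open>real n - 2\<close> to \<open>n\<close> loses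
  \<open>2 * (p - 2 * \<delta>)\<close>, which is at most 2.\<close>

lemma coex_ratio_ge:
  fixes p \<delta> :: real
  assumes "coex_attains n \<F> (nat \<lceil>(p - 2 * \<delta>) * (real n - 2)\<rceil>)" "n \<ge> 2" "p \<le> 1" "0 \<le> \<delta>"
  shows "p - 2 * \<delta> - 2 / n \<le> coex n \<F> / n"
proof -
  have "(p - 2 * \<delta>) * (real n - 2) \<le> coex n \<F>"
    using le_coexI[OF assms(1,2)] by linarith
  moreover have "(p - 2 * \<delta>) * (real n - 2) \<ge> (p - 2 * \<delta>) * n - 2"
    using assms(3,4) by (simp add: algebra_simps)
  ultimately have "(p - 2 * \<delta>) * n - 2 \<le> coex n \<F>" by linarith
  then have "((p - 2 * \<delta>) * n - 2) / n \<le> coex n \<F> / n"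
    by (rule divide_right_mono) simp
  also have "((p - 2 * \<delta>) * n - 2) / n = p - 2 * \<delta> - 2 / n"
    using \<open>n \<ge> 2\<close> by (simp add: diff_divide_distrib)
  finally show ?thesis .
qed

lemma eventually_square_mult_exp_less_1:
  fixes \<delta> :: real
  assumes "\<delta> > 0"
  shows "\<forall>\<^sub>F n in sequentially. real n ^ 2 * exp (- (\<delta>\<^sup>2 * (real n - 2))) < 1"
proof (rule order_tendstoD)
  show "(\<lambda>n. real n ^ 2 * exp (- (\<delta>\<^sup>2 * (real n - 2)))) \<longlonglongrightarrow> 0"
    using assms by real_asymp
qed simp

text \<open>Sample \<open>m\<close> vertices from an extremal 3-graph on \<open>N\<close> vertices.
  How large \<open>N\<close> must be depends on \<open>m\<close>, hence the nested
  quantifiers.\<close>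

lemma coex_ratio_almost_antimono:
  fixes \<epsilon> :: real
  assumes ne: "\<And>F. F \<in> \<F> \<Longrightarrow> edges F \<noteq> {}" and "\<epsilon> > 0"
  shows "\<forall>\<^sub>F m in sequentially. \<forall>\<^sub>F N in sequentially. coex N \<F> / N - \<epsilon> \<le> coex m \<F> / m"
proof -
  \<comment> \<open>The loss \<open>2 * \<delta>\<close> uses half of \<open>\<epsilon>\<close>; the
    other half pays for \<open>2 / m\<close>.\<close>
  define \<delta> where "\<delta> = \<epsilon> / 4"
  have \<delta>: "\<delta> > 0" using assms by (simp add: \<delta>_def)
  have "\<forall>\<^sub>F m in sequentially. real m ^ 2 * exp (- (\<delta>\<^sup>2 * (real m - 2))) < 1"
    using \<delta> by (rule eventually_square_mult_exp_less_1)
  moreover have "\<forall>\<^sub>F m in sequentially. 2 / real m \<le> \<epsilon> / 2"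
    using \<open>\<epsilon> > 0\<close> by real_asymp
  moreover have "\<forall>\<^sub>F m in sequentially. m \<ge> (2::nat)" by (rule eventually_ge_at_top)
  ultimately show ?thesis
  proof eventually_elim
    case (elim m)
    \<comment> \<open>With \<open>m\<close> fixed, only the collision term depends on
      \<open>N\<close>, and it vanishes in the limit.\<close>
    have "(\<lambda>N. real m ^ 2 * (exp (- (\<delta>\<^sup>2 * (real m - 2))) + 1 / real N))
        \<longlonglongrightarrow> real m ^ 2 * (exp (- (\<delta>\<^sup>2 * (real m - 2))) + 0)"
      by (intro tendsto_intros lim_1_over_n)
    then have "\<forall>\<^sub>F N in sequentially. real m ^ 2 * (exp (- (\<delta>\<^sup>2 * (real m - 2))) + 1 / real N) < 1"
      by (rule order_tendstoD) (use elim in simp)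
    moreover have "\<forall>\<^sub>F N in sequentially. N \<ge> (2::nat)" by (rule eventually_ge_at_top)
    ultimately show ?case
    proof eventually_elim
      case (elim N)
      define p where "p = coex N \<F> / N"
      have att: "coex_attains N \<F> (coex N \<F>)" using coex_attains_coex elim ne by blast
      have p: "0 \<le> p" "p \<le> 1"
        using coex_attains_le[OF att] elim by (auto simp: p_def)
      obtain G :: "nat hypergraph" where G: "three_graph G" "card (verts G) = N"
        "\<And>x y. x \<in> verts G \<Longrightarrow> y \<in> verts G \<Longrightarrow> x \<noteq> y \<Longrightarrow> coex N \<F> \<le> codegree G x y"
        "\<And>F. F \<in> \<F> \<Longrightarrow> \<not> contains_copy G F"
        using att unfolding coex_attains_def by blast
      have "coex_attains m \<F> (nat \<lceil>(p - 2 * \<delta>) * (real m - 2)\<rceil>)"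
        using G p \<delta> elim \<open>2 \<le> m\<close> by (intro coex_attains_sample[of G N]) (auto simp: p_def)
      from coex_ratio_ge[OF this \<open>2 \<le> m\<close> \<open>p \<le> 1\<close>]
      have "p - 2 * \<delta> - 2 / m \<le> coex m \<F> / m" using \<delta> by simp
      with \<open>2 / real m \<le> \<epsilon> / 2\<close> show ?case
        unfolding p_def[symmetric] by (simp add: \<delta>_def)
    qed
  qed
qed

text \<open>A bounded sequence has a convergent monotone subsequence, with limit \<open>L\<close>
  say. Every late \<open>b m\<close> nearly bounds \<open>L\<close> from above, and a single late
  term of the subsequence nearly bounds all further terms from above.\<close>

lemma almost_antimono_convergent:
  fixes b :: "nat \<Rightarrow> real"
  assumes "Bseq b"
    and anti: "\<And>\<epsilon>. \<epsilon> > 0 \<Longrightarrow> \<forall>\<^sub>F m in sequentially. \<forall>\<^sub>F n in sequentially. b n - \<epsilon> \<le> b m"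
  shows "convergent b"
proof -
  obtain r :: "nat \<Rightarrow> nat" where r: "strict_mono r" "monoseq (\<lambda>k. b (r k))"
    using seq_monosub by blast
  have "Bseq (\<lambda>k. b (r k))" using Bseq_subseq[OF \<open>Bseq b\<close>] .
  then obtain L where L: "(\<lambda>k. b (r k)) \<longlonglongrightarrow> L"
    using Bseq_monoseq_convergent r(2) convergent_def by blast
  have sub: "filterlim r sequentially sequentially" using r(1) by (rule filterlim_subseq)
  have "b \<longlonglongrightarrow> L"
  proof (rule order_tendstoI)
    fix y assume "y < L"
    have "\<forall>\<^sub>F m in sequentially. \<forall>\<^sub>F n in sequentially. b n - (L - y) / 2 \<le> b m"
      using anti \<open>y < L\<close> by simp
    then show "\<forall>\<^sub>F m in sequentially. y < b m"
    proof eventually_elim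
      case (elim m)
      then have "\<forall>\<^sub>F k in sequentially. b (r k) \<le> b m + (L - y) / 2"
        using filterlim_iff sub by (fastforce simp: algebra_simps)
      \<comment> \<open>Rearranged, this is \<open>b m \<ge> (L + y) / 2\<close>, which exceeds
        \<open>y\<close>.\<close>
      with L have "L \<le> b m + (L - y) / 2"
        using tendsto_upperbound by fastforce
      with \<open>y < L\<close> show ?case by (simp add: field_simps)
    qed
  next
    fix y assume "L < y"
    have "\<forall>\<^sub>F m in sequentially. \<forall>\<^sub>F n in sequentially. b n - (y - L) / 2 \<le> b m"
      using anti \<open>L < y\<close> by simp
    then have "\<forall>\<^sub>F k in sequentially. \<forall>\<^sub>F n in sequentially. b n - (y - L) / 2 \<le> b (r k)"
      using filterlim_iff sub by fastforce
    moreover have "\<forall>\<^sub>F k in sequentially. b (r k) < (L + y) / 2"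
      using L \<open>L < y\<close> by (intro order_tendstoD) auto
    ultimately have "\<forall>\<^sub>F k in sequentially. \<forall>\<^sub>F n in sequentially. b n < y"
    proof eventually_elim
      case (elim k)
      from elim(1) show ?case by eventually_elim (use elim(2) in \<open>simp add: field_simps\<close>)
    qed
    \<comment> \<open>The inner statement does not mention \<open>k\<close>, so one good
      \<open>k\<close> suffices.\<close>
    then show "\<forall>\<^sub>F n in sequentially. b n < y" by simp
  qed
  then show ?thesis by (auto simp: convergent_def)
qed

text \<open>The value of \<open>lim\<close> is informative only for a convergent sequence, so
  convergence is shown first, with denominator \<open>n\<close>. The factor
  \<open>n / (n - 2)\<close> tends to 1 and leaves the limit unchanged.\<close>

lemma codegree_density_geI:
  fixes c :: real
  assumes ne: "\<And>F. F \<in> \<F> \<Longrightarrow> edges F \<noteq> {}"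
    and lower: "\<And>\<epsilon>. \<epsilon> > 0 \<Longrightarrow> \<forall>\<^sub>F n in sequentially. c - \<epsilon> \<le> coex n \<F> / n"
  shows "codegree_density \<F> \<ge> c"
proof -
  let ?b = "\<lambda>n. real (coex n \<F>) / real n"
  have le1: "?b n \<le> 1" if "n \<ge> 2" for n
    using coex_attains_le[OF coex_attains_coex[OF that ne] that] that by auto
  have "Bseq ?b"
    unfolding Bfun_def using le1
    by (intro exI[of _ 1] conjI eventually_sequentiallyI[of 2]) auto
  then have "convergent ?b"
    using coex_ratio_almost_antimono[OF ne] by (rule almost_antimono_convergent)
  then obtain L where L: "?b \<longlonglongrightarrow> L" by (auto simp: convergent_def)
  have "c - \<epsilon> \<le> L" if "\<epsilon> > 0" for \<epsilon>
    using tendsto_lowerbound[OF L lower[OF that]] by simp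
  then have "c \<le> L" by (meson field_le_epsilon diff_le_eq)
  have "(\<lambda>n. real n / (real n - 2)) \<longlonglongrightarrow> 1" by real_asymp
  from tendsto_mult[OF L this] have "(\<lambda>n. ?b n * (real n / (real n - 2))) \<longlonglongrightarrow> L" by simp
  moreover have "\<forall>\<^sub>F n in sequentially. ?b n * (real n / (real n - 2)) = coex n \<F> / (real n - 2)"
    by (intro eventually_sequentiallyI[of 1]) auto
  ultimately have "(\<lambda>n. coex n \<F> / (real n - 2)) \<longlonglongrightarrow> L"
    by (rule Lim_transform_eventually)
  with \<open>c \<le> L\<close> show ?thesis by (simp add: codegree_density_def limI)
qed

section \<open>The 3-graph of a colouring of pairs\<close>

text \<open>Edges are unordered, so the least vertex is recovered by \<open>Min\<close>; injectivity
  on the other two vertices says that their pairs with it have different colours.\<close>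

definition colour_graph :: "nat \<Rightarrow> (nat \<times> nat \<Rightarrow> 'c) \<Rightarrow> nat hypergraph" where
  "colour_graph n c = ({..<n}, {e. e \<subseteq> {..<n} \<and> card e = 3 \<and>
      inj_on (\<lambda>j. c (Min e, j)) (e - {Min e})})"

lemma colour_graph_edge_iff:
  assumes "i < j" "i < k" "j \<noteq> k"
  shows "{i, j, k} \<in> edges (colour_graph n c) \<longleftrightarrow> j < n \<and> k < n \<and> c (i, j) \<noteq> c (i, k)"
proof -
  have "Min {i, j, k} = i" using assms by (intro Min_eqI) auto
  moreover have "{i, j, k} - {i} = {j, k}" using assms by auto
  ultimately show ?thesis using assms by (auto simp: colour_graph_def inj_on_def)
qed

lemma three_graph_colour_graph: "three_graph (colour_graph n c)"
  by (auto simp: three_graph_def colour_graph_def)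

text \<open>Turns a copy into a clique inside the host. By injectivity of the isomorphism, a triple
  whose image is an edge is itself an edge.\<close>

lemma contains_copy_complete:
  assumes "contains_copy G (complete_three_graph t)"
  obtains A where "A \<subseteq> verts G" "card A = t" "\<And>e. e \<subseteq> A \<Longrightarrow> card e = 3 \<Longrightarrow> e \<in> edges G"
proof -
  obtain H h where H: "three_graph H" "verts H \<subseteq> verts G" "edges H \<subseteq> edges G"
    and h: "bij_betw h (verts H) {1..t}" "(`) h ` edges H = {e. e \<subseteq> {1..t} \<and> card e = 3}"
    using assms
    by (auto simp: contains_copy_def subgraph_def isomorphic_def complete_three_graph_def)
  have inj: "inj_on h (verts H)" using h(1) by (simp add: bij_betw_def)
  have "e \<in> edges G" if e: "e \<subseteq> verts H" "card e = 3" for e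
  proof -
    have "inj_on h e" using inj e(1) inj_on_subset by blast
    then have "card (h ` e) = 3" using e(2) by (simp add: card_image)
    moreover have "h ` e \<subseteq> {1..t}" using e(1) bij_betw_imp_surj_on[OF h(1)] by blast
    ultimately have "h ` e \<in> (`) h ` edges H" unfolding h(2) by simp
    then obtain e' where e': "e' \<in> edges H" "h ` e = h ` e'" by blast
    moreover have "e' \<subseteq> verts H" using e' H(1) by (auto simp: three_graph_def)
    ultimately have "e = e'" using inj_on_image_eq_iff[OF inj] e(1) by blast
    then show ?thesis using e' H by auto
  qed
  moreover have "card (verts H) = t" using bij_betw_same_card[OF h(1)] by simp
  ultimately show ?thesis using that H(2) by blast
qed

lemma colour_graph_complete_free:
  assumes c: "\<And>i j. i < n \<Longrightarrow> j < n \<Longrightarrow> c (i, j) < s"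
  shows "\<not> contains_copy (colour_graph n c) (complete_three_graph (s + 2))"
proof
  assume "contains_copy (colour_graph n c) (complete_three_graph (s + 2))"
  then obtain A where A: "A \<subseteq> {..<n}" "card A = s + 2"
    "\<And>e. e \<subseteq> A \<Longrightarrow> card e = 3 \<Longrightarrow> e \<in> edges (colour_graph n c)"
    by (elim contains_copy_complete) (simp add: colour_graph_def)
  have fin: "finite A" using A(1) finite_subset by blast
  define i where "i = Min A"
  have "A \<noteq> {}" using A(2) by auto
  then have i: "i \<in> A" "\<And>j. j \<in> A \<Longrightarrow> i \<le> j" using fin by (auto simp: i_def)
  have "(\<lambda>j. c (i, j)) ` (A - {i}) \<subseteq> {..<s}" using A(1) i(1) c by auto
  then have "card ((\<lambda>j. c (i, j)) ` (A - {i})) \<le> s"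
    using card_mono[of "{..<s}"] by fastforce
  also have "s < card (A - {i})" using A(2) i fin by simp
  finally have "\<not> inj_on (\<lambda>j. c (i, j)) (A - {i})" by (rule pigeonhole)
  then obtain j k where jk: "j \<in> A - {i}" "k \<in> A - {i}" "j \<noteq> k" "c (i, j) = c (i, k)"
    by (auto simp: inj_on_def)
  have lt: "i < j" "i < k" using jk i by (auto simp: le_neq_implies_less)
  have "{i, j, k} \<in> edges (colour_graph n c)"
    using A(3)[of "{i, j, k}"] jk i lt by auto
  then show False using colour_graph_edge_iff[OF lt jk(3)] jk(4) by blast
qed

text \<open>Union bound over the pairs \<open>x < y\<close> in a random colouring. For a fixed pair,
  each third vertex compares two colours; fixing one of the two in advance makes the comparisons
  independent, which is why the conditional Chernoff bound is applied.\<close>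

lemma coex_attains_complete:
  fixes \<epsilon> :: real
  assumes "s > 0" "n \<ge> 2" "0 \<le> \<epsilon>"
    and small: "real n ^ 2 * exp (- (\<epsilon>\<^sup>2 * (real n - 2))) < 1"
  shows "coex_attains n {complete_three_graph (s + 2)} (nat \<lceil>(1 - 1 / s - 2 * \<epsilon>) * (real n - 2)\<rceil>)"
proof -
  define p where "p = 1 - 1 / real s"
  define I where "I = {..<n} \<times> {..<n}"
  define W where "W = {..<s}"
  define \<Omega> where "\<Omega> = I \<rightarrow>\<^sub>E W"
  define S where "S x y = {..<n} - {x, y}" for x y
  \<comment> \<open>For \<open>x < y\<close> the least of the three vertices is \<open>z\<close> if
    \<open>z < x\<close>, and \<open>x\<close> otherwise. The colour of \<open>e x z\<close> stays
    random, and \<open>T\<close> consists of the colours differing from that of the partner pair,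
    \<open>(z, y)\<close> or \<open>(x, y)\<close>.\<close>
  define e where "e x z = (if z < x then (z, x) else (x, z))" for x z :: nat
  define T where "T x y f z = W - {f (if z < x then (z, y) else (x, y))}"
    for x y :: nat and f :: "nat \<times> nat \<Rightarrow> nat" and z
  define B where "B = (\<lambda>(x, y). {f \<in> \<Omega>. card {z \<in> S x y. f (e x z) \<in> T x y f z}
      < (p - 2 * \<epsilon>) * card (S x y)})"
  define D where "D = {(x, y). x < y \<and> y < n}"
  have p: "0 \<le> p" "p \<le> 1" using assms by (auto simp: p_def)
  have finI: "finite I" and finW: "finite W" and cardW: "card W = s" by (auto simp: I_def W_def)
  have fin\<Omega>: "finite \<Omega>" unfolding \<Omega>_def using finI finW by (intro finite_PiE) auto
  have DI: "D \<subseteq> I" by (auto simp: D_def I_def)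
  then have finD: "finite D" using finI finite_subset by blast
  have cardS: "real (card (S x y)) = real n - 2" if "(x, y) \<in> D" for x y
    using that assms by (auto simp: S_def D_def card_Diff_subset of_nat_diff)
  have cardB: "real (card (B xy)) \<le> exp (- (\<epsilon>\<^sup>2 * (real n - 2))) * real s ^ card I" if xy_D: "xy \<in> D" for xy
  proof -
    obtain x y where xy: "xy = (x, y)" "x < y" "y < n" using xy_D by (auto simp: D_def)
    \<comment> \<open>Partner pairs are never among the random pairs, so \<open>T\<close> depends
      only on the conditioned colours.\<close>
    have out: "(if z < x then (z, y) else (x, y)) \<in> I - e x ` S x y" if "z \<in> S x y" for z
      using that xy by (auto simp: I_def S_def e_def split: if_splits)
    have "card {f \<in> I \<rightarrow>\<^sub>E W. card {z \<in> S x y. f (e x z) \<in> T x y f z} < (p - 2 * \<epsilon>) * card (S x y)}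
      \<le> exp (- (\<epsilon>\<^sup>2 * card (S x y))) * card W ^ card I"
    proof (rule card_few_hits_le_conditional[OF finI finW p \<open>0 \<le> \<epsilon>\<close>])
      show "inj_on (e x) (S x y)" by (auto simp: inj_on_def e_def split: if_splits)
      show "e x ` S x y \<subseteq> I" using xy by (auto simp: e_def S_def I_def)
      fix f z assume f: "f \<in> I - e x ` S x y \<rightarrow> W" and z: "z \<in> S x y"
      show "T x y f z \<subseteq> W" by (auto simp: T_def)
      have "f (if z < x then (z, y) else (x, y)) \<in> W" using out[OF z] f by blast
      then have "card (T x y f z) = s - 1" using finW cardW by (simp add: T_def)
      then show "p * card W \<le> card (T x y f z)"
        using \<open>s > 0\<close> cardW by (simp add: p_def of_nat_diff field_simps)
    next
      fix f f' :: "nat \<times> nat \<Rightarrow> nat" and z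
      assume z: "z \<in> S x y" and eq: "\<And>u. u \<in> I - e x ` S x y \<Longrightarrow> f u = f' u"
      show "T x y f z = T x y f' z" unfolding T_def using eq[OF out[OF z]] by simp
    qed
    then show ?thesis using cardS[of x y] xy_D xy cardW by (simp add: B_def \<Omega>_def)
  qed
  have "real (card (\<Union>xy\<in>D. B xy)) \<le> real (\<Sum>xy\<in>D. card (B xy))"
    using card_UN_le[OF finD] by (simp only: of_nat_le_iff)
  also have "\<dots> \<le> (\<Sum>xy\<in>D. exp (- (\<epsilon>\<^sup>2 * (real n - 2))) * real s ^ card I)"
    unfolding of_nat_sum using cardB by (intro sum_mono)
  also have "\<dots> = real (card D) * (exp (- (\<epsilon>\<^sup>2 * (real n - 2))) * real s ^ card I)"
    by simp
  also have "\<dots> \<le> real n ^ 2 * (exp (- (\<epsilon>\<^sup>2 * (real n - 2))) * real s ^ card I)"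
  proof (rule mult_right_mono)
    have "card D \<le> card I" using DI finI by (intro card_mono) auto
    then show "real (card D) \<le> real n ^ 2"
      by (simp add: I_def power2_eq_square flip: of_nat_mult)
  qed simp
  also have "\<dots> = (real n ^ 2 * exp (- (\<epsilon>\<^sup>2 * (real n - 2)))) * real s ^ card I"
    by simp
  also have "\<dots> < 1 * real s ^ card I"
    using small \<open>s > 0\<close> by (intro mult_strict_right_mono) auto
  also have "\<dots> = card \<Omega>" using finI cardW by (simp add: \<Omega>_def card_PiE)
  finally have "card (\<Union>xy\<in>D. B xy) < card \<Omega>" by simp
  moreover have "(\<Union>xy\<in>D. B xy) \<subseteq> \<Omega>" by (auto simp: B_def)
  ultimately obtain c where c: "c \<in> \<Omega>" "c \<notin> (\<Union>xy\<in>D. B xy)"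
    by (metis less_irrefl subsetI subset_antisym)
  let ?G = "colour_graph n c" and ?d = "nat \<lceil>(1 - 1 / s - 2 * \<epsilon>) * (real n - 2)\<rceil>"
  have less: "?d \<le> codegree ?G x y" if xy: "x < y" "y < n" for x y
  proof -
    have D: "(x, y) \<in> D" using xy by (simp add: D_def)
    have "(p - 2 * \<epsilon>) * (real n - 2) \<le> card {z \<in> S x y. c (e x z) \<in> T x y c z}"
      using c D cardS[OF D] by (force simp: B_def)
    moreover have "card {z \<in> S x y. c (e x z) \<in> T x y c z} \<le> codegree ?G x y"
      unfolding codegree_eq_card[OF three_graph_colour_graph less_imp_neq[OF xy(1)]]
    proof (rule card_mono)
      show "finite {z \<in> verts ?G - {x, y}. {x, y, z} \<in> edges ?G}"
        by (simp add: colour_graph_def)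
      have "{x, y, z} \<in> edges ?G" if z: "z \<in> S x y" "c (e x z) \<in> T x y c z" for z
      proof (cases "z < x")
        case True
        then have "{z, x, y} \<in> edges ?G"
          using z xy by (subst colour_graph_edge_iff) (auto simp: e_def T_def)
        then show ?thesis by (simp add: insert_commute)
      next
        case False
        then have "{x, y, z} \<in> edges ?G"
          using z xy by (subst colour_graph_edge_iff) (auto simp: e_def T_def S_def)
        then show ?thesis .
      qed
      then show "{z \<in> S x y. c (e x z) \<in> T x y c z} \<subseteq> {z \<in> verts ?G - {x, y}. {x, y, z} \<in> edges ?G}"
        by (auto simp: S_def colour_graph_def)
    qed
    ultimately show ?thesis unfolding p_def by linarith
  qed
  show ?thesis unfolding coex_attains_def
  proof (intro exI conjI ballI impI)
    show "three_graph ?G" by (rule three_graph_colour_graph)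
    show "card (verts ?G) = n" by (simp add: colour_graph_def)
    have "c (i, j) < s" if "i < n" "j < n" for i j
      using c(1) that by (force simp: \<Omega>_def I_def W_def)
    then show "\<not> contains_copy ?G F" if "F \<in> {complete_three_graph (s + 2)}" for F
      using that colour_graph_complete_free by blast
    fix x y assume "x \<in> verts ?G" "y \<in> verts ?G" "x \<noteq> y"
    then show "?d \<le> codegree ?G x y"
      using less[of x y] less[of y x] codegree_sym[of ?G x y]
      by (cases "x < y") (auto simp: colour_graph_def)
  qed
qed

section \<open>The lower bound for the density\<close>

theorem theorem5:
  fixes s :: nat
  assumes "s \<ge> 2"
  shows "codegree_density {complete_three_graph (s + 2)} \<ge> 1 - 1 / real s"
proof (rule codegree_density_geI)
  fix F :: "nat hypergraph" assume "F \<in> {complete_three_graph (s + 2)}"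
  moreover have "{1, 2, 3} \<in> edges (complete_three_graph (s + 2))"
    using assms by (auto simp: complete_three_graph_def)
  ultimately show "edges F \<noteq> {}" by blast
next
  fix \<epsilon> :: real assume "\<epsilon> > 0"
  \<comment> \<open>Again \<open>2 * \<delta>\<close> and \<open>2 / n\<close> take half of
    \<open>\<epsilon>\<close> each.\<close>
  define \<delta> where "\<delta> = \<epsilon> / 4"
  have \<delta>: "\<delta> > 0" using \<open>\<epsilon> > 0\<close> by (simp add: \<delta>_def)
  let ?\<F> = "{complete_three_graph (s + 2)}" and ?p = "1 - 1 / real s"
  have "\<forall>\<^sub>F n in sequentially. real n ^ 2 * exp (- (\<delta>\<^sup>2 * (real n - 2))) < 1"
    using \<delta> by (rule eventually_square_mult_exp_less_1)
  moreover have "\<forall>\<^sub>F n in sequentially. 2 / real n \<le> \<epsilon> / 2"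
    using \<open>\<epsilon> > 0\<close> by real_asymp
  moreover have "\<forall>\<^sub>F n in sequentially. n \<ge> (2::nat)" by (rule eventually_ge_at_top)
  ultimately show "\<forall>\<^sub>F n in sequentially. ?p - \<epsilon> \<le> coex n ?\<F> / n"
  proof eventually_elim
    case (elim n)
    have "coex_attains n ?\<F> (nat \<lceil>(?p - 2 * \<delta>) * (real n - 2)\<rceil>)"
      using elim \<delta> assms by (intro coex_attains_complete) auto
    from coex_ratio_ge[OF this \<open>2 \<le> n\<close>]
    have "?p - 2 * \<delta> - 2 / n \<le> coex n ?\<F> / n" using \<delta> by simp
    with elim(2) show ?case by (simp add: \<delta>_def)
  qed
qed

end
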